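(* There are no minimal compact real hypersurfaces in $\mathbb{C}H^n$ such that $$|A|^2\leq\sqrt{n^2+12n+12}-n-4.$$
   Context: $\mathbb{C}H^n$ is the complex hyperbolic space of complex dimension $n$ with constant holomorphic sectional curvature $-4$. A real hypersurface is a submanifold of real codimension one; $A$ is its shape operator with respect to a unit normal vector field, and $|A|^2$ its squared norm (sum of squares of principal curvatures). *)

theory Defs
  imports "HOL-Analysis.Analysis"
begin

section \<open>Smooth maps between Euclidean spaces\<close>

text \<open>Class \<open>C\<^sup>k\<close> on an open set \<open>S\<close>, by recursion on the directional derivatives.\<close>

fun Ck_on :: "nat \<Rightarrow> 'a::euclidean_space set \<Rightarrow> ('a \<Rightarrow> 'b::euclidean_space) \<Rightarrow> bool" where
  "Ck_on 0 S f \<longleftrightarrow> continuous_on S f"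
| "Ck_on (Suc k) S f \<longleftrightarrow>
     f differentiable_on S \<and> (\<forall>v. Ck_on k S (\<lambda>x. frechet_derivative f (at x) v))"

definition smooth_on :: "'a::euclidean_space set \<Rightarrow> ('a \<Rightarrow> 'b::euclidean_space) \<Rightarrow> bool" where
  "smooth_on S f \<longleftrightarrow> (\<forall>k. Ck_on k S f)"


section \<open>Smooth manifolds\<close>

text \<open>A chart is a pair \<open>(W, x)\<close> of an open set \<open>W\<close> of the space and a homeomorphism \<open>x\<close> from
  \<open>W\<close> onto an open subset of Euclidean space; \<open>inv_into W x\<close> is the local parametrization.
  The dimension of the manifold is \<open>CARD('m)\<close>. Atlases need not be maximal.\<close>

type_synonym ('p, 'm) chart = "'p set \<times> ('p \<Rightarrow> real^'m)"

definition is_chart :: "'p topology \<Rightarrow> ('p, 'm::finite) chart \<Rightarrow> bool" where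
  "is_chart X c \<longleftrightarrow> (case c of (W, x) \<Rightarrow>
     openin X W \<and> open (x ` W) \<and>
     homeomorphic_map (subtopology X W) (top_of_set (x ` W)) x)"

definition smooth_atlas :: "'p topology \<Rightarrow> ('p, 'm::finite) chart set \<Rightarrow> bool" where
  "smooth_atlas X \<A> \<longleftrightarrow>
     (\<forall>c\<in>\<A>. is_chart X c) \<and>
     (\<Union>(W, x)\<in>\<A>. W) = topspace X \<and>
     (\<forall>(W, x)\<in>\<A>. \<forall>(W', x')\<in>\<A>. smooth_on (x ` (W \<inter> W')) (x' \<circ> inv_into W x))"

definition smooth_manifold :: "'p topology \<Rightarrow> ('p, 'm::finite) chart set \<Rightarrow> bool" where
  "smooth_manifold X \<A> \<longleftrightarrow> Hausdorff_space X \<and> second_countable X \<and> smooth_atlas X \<A>"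


section \<open>Riemannian metrics on open subsets of a Euclidean space\<close>

text \<open>\<open>g z u v\<close> is the inner product of the tangent vectors \<open>u\<close>, \<open>v\<close> at the point \<open>z\<close>.\<close>

type_synonym 'e metric_tensor = "'e \<Rightarrow> 'e \<Rightarrow> 'e \<Rightarrow> real"

text \<open>\<open>christoffel g z u v\<close> is the value at \<open>z\<close> of the Levi-Civita derivative of the constant
  vector field \<open>v\<close> along the constant vector field \<open>u\<close>, characterized by the Koszul formula
  (constant fields commute).\<close>

definition christoffel :: "'e::euclidean_space metric_tensor \<Rightarrow> 'e \<Rightarrow> 'e \<Rightarrow> 'e \<Rightarrow> 'e" where
  "christoffel g z u v = (THE w. \<forall>y. 2 * g z w y =
       frechet_derivative (\<lambda>p. g p v y) (at z) u
     + frechet_derivative (\<lambda>p. g p u y) (at z) v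
     - frechet_derivative (\<lambda>p. g p u v) (at z) y)"

text \<open>The Levi-Civita covariant derivative, at \<open>y\<close> in direction \<open>v\<close>, of a vector field \<open>N\<close>
  along a map \<open>r\<close>.\<close>

definition cov_deriv_along ::
  "'e::euclidean_space metric_tensor \<Rightarrow> ('d::euclidean_space \<Rightarrow> 'e) \<Rightarrow> ('d \<Rightarrow> 'e) \<Rightarrow> 'd \<Rightarrow> 'd \<Rightarrow> 'e" where
  "cov_deriv_along g r N y v =
     frechet_derivative N (at y) v + christoffel g (r y) (frechet_derivative r (at y) v) (N y)"

definition unit_normal_field ::
  "'e::euclidean_space metric_tensor \<Rightarrow> ('d::euclidean_space \<Rightarrow> 'e) \<Rightarrow> 'd set \<Rightarrow> ('d \<Rightarrow> 'e) \<Rightarrow> bool" where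
  "unit_normal_field g r V N \<longleftrightarrow> smooth_on V N \<and>
     (\<forall>y\<in>V. g (r y) (N y) (N y) = 1 \<and> (\<forall>v. g (r y) (N y) (frechet_derivative r (at y) v) = 0))"

text \<open>Weingarten formula: \<open>dr (A v) = - \<nabla>\<^sub>v N\<close>. The tangent space of the hypersurface is
  identified with the parameter space by means of the immersion \<open>r\<close>.\<close>

definition shape_operator ::
  "'e::euclidean_space metric_tensor \<Rightarrow> ('d::euclidean_space \<Rightarrow> 'e) \<Rightarrow> ('d \<Rightarrow> 'e) \<Rightarrow> 'd \<Rightarrow> 'd \<Rightarrow> 'd" where
  "shape_operator g r N y v =
     (THE w. frechet_derivative r (at y) w = - cov_deriv_along g r N y v)"

definition principal_curvatures :: "('d::euclidean_space \<Rightarrow> 'd) \<Rightarrow> real set" where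
  "principal_curvatures A = {k. \<exists>v. v \<noteq> 0 \<and> A v = k *\<^sub>R v}"

text \<open>The sum of the squares of the principal curvatures, counted with multiplicity.\<close>

definition shape_norm_sq :: "('d::euclidean_space \<Rightarrow> 'd) \<Rightarrow> real" where
  "shape_norm_sq A = (\<Sum>k\<in>principal_curvatures A. real (dim {v. A v = k *\<^sub>R v}) * k\<^sup>2)"


section \<open>Complex hyperbolic space\<close>

text \<open>The ball model. With \<open>\<langle>u, v\<rangle>\<close> the standard Hermitian product, the metric is
  \<open>Re (\<langle>u, v\<rangle> / (1 - |z|\<^sup>2) + \<langle>u, z\<rangle> \<langle>z, v\<rangle> / (1 - |z|\<^sup>2)\<^sup>2)\<close>, the multiple of the Bergman metric with
  constant holomorphic sectional curvature -4: on the complex line through the origin it is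
  \<open>|dz|\<^sup>2 / (1 - |z|\<^sup>2)\<^sup>2\<close>, a quarter of the Poincare metric of curvature -1.\<close>

definition hermitian :: "complex^'n \<Rightarrow> complex^'n \<Rightarrow> complex" where
  "hermitian u v = (\<Sum>i\<in>UNIV. u $ i * cnj (v $ i))"

definition CH_ball :: "(complex^'n) set" where
  "CH_ball = ball 0 1"

definition CH_metric :: "(complex^'n) metric_tensor" where
  "CH_metric z u v = Re (
       hermitian u v / of_real (1 - (norm z)\<^sup>2)
     + hermitian u z * hermitian z v / of_real ((1 - (norm z)\<^sup>2)\<^sup>2))"


section \<open>Real hypersurfaces\<close>

text \<open>A real hypersurface is a nonempty smooth manifold of real dimension \<open>2n - 1\<close> together with a
  smooth immersion \<open>f\<close> into the ball. Neither injectivity of \<open>f\<close>, connectedness nor orientability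
  is required; embedded hypersurfaces are the case where \<open>f\<close> is an inclusion.\<close>

definition real_hypersurface ::
  "'p topology \<Rightarrow> ('p, 'm::finite) chart set \<Rightarrow> ('p \<Rightarrow> complex^'n) \<Rightarrow> bool" where
  "real_hypersurface X \<A> f \<longleftrightarrow>
     CARD('m) + 1 = 2 * CARD('n) \<and>
     topspace X \<noteq> {} \<and>
     smooth_manifold X \<A> \<and>
     f ` topspace X \<subseteq> CH_ball \<and>
     (\<forall>(W, x)\<in>\<A>. smooth_on (x ` W) (f \<circ> inv_into W x) \<and>
        (\<forall>y\<in>x ` W. inj (frechet_derivative (f \<circ> inv_into W x) (at y))))"

text \<open>All shape operators at \<open>p\<close>, expressed in the charts around \<open>p\<close>, with respect to all unit normal
  fields defined near \<open>p\<close>. Two members differ by a sign and conjugation with a coordinate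
  change.\<close>

definition shape_operators_at ::
  "('p, 'm::finite) chart set \<Rightarrow> ('p \<Rightarrow> complex^'n) \<Rightarrow> 'p \<Rightarrow> (real^'m \<Rightarrow> real^'m) set" where
  "shape_operators_at \<A> f p =
     {shape_operator CH_metric (f \<circ> inv_into W x) N (x p) | W x V N.
        (W, x) \<in> \<A> \<and> p \<in> W \<and> open V \<and> x p \<in> V \<and> V \<subseteq> x ` W \<and>
        unit_normal_field CH_metric (f \<circ> inv_into W x) V N}"

definition minimal_hypersurface ::
  "'p topology \<Rightarrow> ('p, 'm::finite) chart set \<Rightarrow> ('p \<Rightarrow> complex^'n) \<Rightarrow> bool" where
  "minimal_hypersurface X \<A> f \<longleftrightarrow>
     (\<forall>p\<in>topspace X. \<forall>A\<in>shape_operators_at \<A> f p. trace (matrix A) = 0)"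

end

(* The farthest point p of a compact hypersurface from the origin of the ball lies on a geodesic
   sphere that encloses the hypersurface. Geodesic spheres of complex hyperbolic space are strictly
   convex, so the shape operator at p is definite with respect to the induced metric and its trace
   cannot vanish. *)

theory Submission
  imports Defs
begin

section \<open>Calculus of smooth maps\<close>

text \<open>Distance from the origin increases with the Euclidean norm, so the farthest point
  maximizes \<open>norm (f q)\<close>. No geodesic sphere occurs in the formulas: the comparison
  uses the first and second derivatives of the squared norm at its maximum, inserted into the second
  fundamental form, which Koszul's formula expresses through derivatives of
  \<open>CH_metric\<close>. Two obstacles shape the rest. Minimality quantifies over the unit normal
  fields near a point and would hold vacuously if none existed, so a smooth local unit normal must
  be built, with prescribed direction at the farthest point. And \<open>christoffel\<close> and
  \<open>shape_operator\<close> are definite descriptions, so the vectors they describe must first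
  be shown to exist uniquely. Finally, the trace is that of a coordinate matrix while definiteness
  refers to the induced metric, hence the orthonormal expansions for arbitrary inner
  products.\<close>

lemma Ck_on_cong:
  assumes "open S" "\<And>x. x \<in> S \<Longrightarrow> f x = g x" "Ck_on k S f"
  shows "Ck_on k S g"
  using assms(2,3)
proof (induction k arbitrary: f g)
  case 0
  then show ?case by (simp cong: continuous_on_cong)
next
  case (Suc k)
  have g: "(g has_derivative frechet_derivative f (at x)) (at x)" if "x \<in> S" for x
  proof (rule has_derivative_transform_within_open[OF _ \<open>open S\<close> that Suc.prems(1)])
    show "(f has_derivative frechet_derivative f (at x)) (at x)"
      using Suc.prems(2) that assms(1)
      by (simp add: differentiable_on_eq_differentiable_at frechet_derivative_works)
  qed
  then have "frechet_derivative f (at x) v = frechet_derivative g (at x) v" if "x \<in> S" for x v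
    using that frechet_derivative_at by metis
  moreover have "g differentiable_on S"
    using g by (meson differentiableI differentiable_at_imp_differentiable_on)
  ultimately show ?case
    using Suc.prems(2) Suc.IH[of "\<lambda>x. frechet_derivative f (at x) v" for v] by simp
qed

text \<open>Lets the closure properties be proved from an explicit derivative \<open>f'\<close>
  instead of \<open>frechet_derivative\<close>, which is only a choice of derivative.\<close>

lemma Ck_on_SucI:
  assumes "open S"
    and "\<And>x. x \<in> S \<Longrightarrow> (f has_derivative f' x) (at x)"
    and "\<And>v. Ck_on k S (\<lambda>x. f' x v)"
  shows "Ck_on (Suc k) S f"
proof -
  have "f' x v = frechet_derivative f (at x) v" if "x \<in> S" for x v
    using assms(2)[OF that] frechet_derivative_at by metis
  moreover have "f differentiable_on S"
    using assms(2) by (meson differentiableI differentiable_at_imp_differentiable_on)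
  ultimately show ?thesis
    using assms(3) Ck_on_cong[OF assms(1), of "\<lambda>x. f' x v" for v] by simp
qed

lemma Ck_on_Suc_has_derivative:
  assumes "open S" "Ck_on (Suc k) S f" "x \<in> S"
  shows "(f has_derivative frechet_derivative f (at x)) (at x)"
  using assms by (simp add: differentiable_on_eq_differentiable_at frechet_derivative_works)

lemma Ck_on_SucD: "Ck_on (Suc k) S f \<Longrightarrow> Ck_on k S f"
proof (induction k arbitrary: f)
  case 0
  then show ?case by (simp add: differentiable_imp_continuous_on)
next
  case (Suc k)
  then show ?case by (metis Ck_on.simps(2))
qed

lemma Ck_on_subset: "Ck_on k S f \<Longrightarrow> T \<subseteq> S \<Longrightarrow> Ck_on k T f"
  by (induction k arbitrary: f) (auto intro: continuous_on_subset differentiable_on_subset)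

lemma Ck_on_const: "Ck_on k S (\<lambda>x. c)"
  by (induction k arbitrary: c) (auto simp: frechet_derivative_const)

lemma Ck_on_add:
  assumes "open S" "Ck_on k S f" "Ck_on k S g"
  shows "Ck_on k S (\<lambda>x. f x + g x)"
  using assms(2,3)
proof (induction k arbitrary: f g)
  case 0
  then show ?case by (simp add: continuous_on_add)
next
  case (Suc k)
  show ?case
    by (rule Ck_on_SucI[OF \<open>open S\<close> has_derivative_add[OF
          Ck_on_Suc_has_derivative[OF \<open>open S\<close> Suc.prems(1)]
          Ck_on_Suc_has_derivative[OF \<open>open S\<close> Suc.prems(2)]]])
      (use Suc in auto)
qed

lemma Ck_on_bounded_linear:
  assumes "open S" "bounded_linear L" "Ck_on k S f"
  shows "Ck_on k S (\<lambda>x. L (f x))"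
  using assms(3)
proof (induction k arbitrary: f)
  case 0
  then show ?case using assms(2) by (simp add: bounded_linear.continuous_on)
next
  case (Suc k)
  show ?case
    by (rule Ck_on_SucI[OF \<open>open S\<close> bounded_linear.has_derivative[OF assms(2)
          Ck_on_Suc_has_derivative[OF \<open>open S\<close> Suc.prems]]])
      (use Suc in auto)
qed

lemma Ck_on_bounded_bilinear:
  assumes "open S" "bounded_bilinear bop" "Ck_on k S f" "Ck_on k S g"
  shows "Ck_on k S (\<lambda>x. bop (f x) (g x))"
  using assms(3,4)
proof (induction k arbitrary: f g)
  case 0
  then show ?case using assms(2) by (simp add: bounded_bilinear.continuous_on)
next
  case (Suc k)
  show ?case
    by (rule Ck_on_SucI[OF \<open>open S\<close> bounded_bilinear.FDERIV[OF assms(2)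
          Ck_on_Suc_has_derivative[OF \<open>open S\<close> Suc.prems(1)]
          Ck_on_Suc_has_derivative[OF \<open>open S\<close> Suc.prems(2)]]])
      (use Suc Ck_on_SucD[OF Suc.prems(1)] Ck_on_SucD[OF Suc.prems(2)] in
        \<open>auto intro!: Ck_on_add[OF \<open>open S\<close>]\<close>)
qed

text \<open>Differentiation lowers the exponent, so \<open>a\<close> must vary in the induction. Two
  exponents matter later: -1 for the factor 1/(1 - |z|^2) of the metric, and -1/2 for normalizing a
  vector field.\<close>

lemma Ck_on_powr:
  fixes f :: "'a::euclidean_space \<Rightarrow> real"
  assumes "open S" "Ck_on k S f" "\<And>x. x \<in> S \<Longrightarrow> 0 < f x"
  shows "Ck_on k S (\<lambda>x. f x powr a)"
  using assms(2)
proof (induction k arbitrary: a)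
  case 0
  then show ?case using assms(3) by (auto intro!: continuous_on_powr) force
next
  case (Suc k)
  have der: "((\<lambda>x. f x powr a) has_derivative
      (\<lambda>v. a * (f x powr (a - 1) * frechet_derivative f (at x) v))) (at x)" if "x \<in> S" for x
    using has_derivative_powr[OF Ck_on_Suc_has_derivative[OF \<open>open S\<close> Suc.prems that]
        has_derivative_const[of a]] assms(3)[OF that] that
    by (simp add: powr_diff mult_ac)
  show ?case
  proof (rule Ck_on_SucI[OF \<open>open S\<close> der])
    fix v
    show "Ck_on k S (\<lambda>x. a * (f x powr (a - 1) * frechet_derivative f (at x) v))"
      by (intro Ck_on_bounded_bilinear[OF \<open>open S\<close> bounded_bilinear_mult] Ck_on_const
          Suc.IH Ck_on_SucD[OF Suc.prems]) (use Suc.prems in auto)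
  qed
qed

lemma smooth_on_subset: "smooth_on S f \<Longrightarrow> T \<subseteq> S \<Longrightarrow> smooth_on T f"
  unfolding smooth_on_def by (meson Ck_on_subset)

lemma smooth_on_cong:
  "open S \<Longrightarrow> (\<And>x. x \<in> S \<Longrightarrow> f x = g x) \<Longrightarrow> smooth_on S f \<Longrightarrow> smooth_on S g"
  unfolding smooth_on_def by (meson Ck_on_cong)

lemma smooth_on_has_derivative:
  assumes "open S" "smooth_on S f" "x \<in> S"
  shows "(f has_derivative frechet_derivative f (at x)) (at x)"
  using assms unfolding smooth_on_def by (meson Ck_on_Suc_has_derivative)

lemma smooth_on_directional_derivative:
  "smooth_on S f \<Longrightarrow> smooth_on S (\<lambda>x. frechet_derivative f (at x) v)"
  unfolding smooth_on_def using Ck_on.simps(2) by blast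

lemma smooth_on_imp_continuous_on: "smooth_on S f \<Longrightarrow> continuous_on S f"
  unfolding smooth_on_def using Ck_on.simps(1) by blast

lemma smooth_on_const: "smooth_on S (\<lambda>x. c)"
  by (simp add: smooth_on_def Ck_on_const)

lemma smooth_on_add:
  "open S \<Longrightarrow> smooth_on S f \<Longrightarrow> smooth_on S g \<Longrightarrow> smooth_on S (\<lambda>x. f x + g x)"
  by (simp add: smooth_on_def Ck_on_add)

lemma smooth_on_bounded_linear:
  "open S \<Longrightarrow> bounded_linear L \<Longrightarrow> smooth_on S f \<Longrightarrow> smooth_on S (\<lambda>x. L (f x))"
  by (simp add: smooth_on_def Ck_on_bounded_linear)

lemma smooth_on_bounded_bilinear:
  "open S \<Longrightarrow> bounded_bilinear bop \<Longrightarrow> smooth_on S f \<Longrightarrow> smooth_on S g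
    \<Longrightarrow> smooth_on S (\<lambda>x. bop (f x) (g x))"
  by (simp add: smooth_on_def Ck_on_bounded_bilinear)

lemmas smooth_on_inner = smooth_on_bounded_bilinear[OF _ bounded_bilinear_inner]
lemmas smooth_on_scaleR = smooth_on_bounded_bilinear[OF _ bounded_bilinear_scaleR]

lemma smooth_on_mult:
  fixes f g :: "'a::euclidean_space \<Rightarrow> real"
  shows "open S \<Longrightarrow> smooth_on S f \<Longrightarrow> smooth_on S g \<Longrightarrow> smooth_on S (\<lambda>x. f x * g x)"
  by (rule smooth_on_bounded_bilinear[OF _ bounded_bilinear_mult])

lemma smooth_on_diff:
  assumes "open S" "smooth_on S f" "smooth_on S g"
  shows "smooth_on S (\<lambda>x. f x - g x)"
  using smooth_on_add[OF assms(1,2) smooth_on_bounded_linear[OF assms(1)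
        bounded_linear_minus[OF bounded_linear_ident] assms(3)]] by simp

lemma smooth_on_powr:
  fixes f :: "'a::euclidean_space \<Rightarrow> real"
  shows "open S \<Longrightarrow> smooth_on S f \<Longrightarrow> (\<And>x. x \<in> S \<Longrightarrow> 0 < f x) \<Longrightarrow> smooth_on S (\<lambda>x. f x powr a)"
  by (simp add: smooth_on_def Ck_on_powr)

lemma smooth_on_sum:
  assumes "open S" "\<And>i. i \<in> I \<Longrightarrow> smooth_on S (f i)"
  shows "smooth_on S (\<lambda>x. \<Sum>i\<in>I. f i x)"
  using assms(2)
  by (induction I rule: infinite_finite_induct) (auto intro: smooth_on_const smooth_on_add[OF assms(1)])

lemma smooth_on_prod:
  fixes f :: "'i \<Rightarrow> 'a::euclidean_space \<Rightarrow> real"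
  assumes "open S" "\<And>i. i \<in> I \<Longrightarrow> smooth_on S (f i)"
  shows "smooth_on S (\<lambda>x. \<Prod>i\<in>I. f i x)"
  using assms(2)
  by (induction I rule: infinite_finite_induct) (auto intro: smooth_on_const smooth_on_mult[OF assms(1)])

lemma smooth_on_det:
  fixes M :: "'a::euclidean_space \<Rightarrow> real^'m^'m"
  assumes "open S" "\<And>i j. smooth_on S (\<lambda>x. M x $ i $ j)"
  shows "smooth_on S (\<lambda>x. det (M x))"
  unfolding det_def
  by (intro smooth_on_sum smooth_on_mult smooth_on_prod smooth_on_const assms)

section \<open>Positive definite forms\<close>

text \<open>The metric varies with the point and is also pulled back to the parameter space, so
  inner products are handled as a predicate on forms beside the fixed one of the type class.\<close>

definition inner_form :: "('a::euclidean_space \<Rightarrow> 'a \<Rightarrow> real) \<Rightarrow> bool" where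
  "inner_form h \<longleftrightarrow> bilinear h \<and> (\<forall>u v. h u v = h v u) \<and> (\<forall>v. v \<noteq> 0 \<longrightarrow> 0 < h v v)"

lemma inner_form_pullback:
  assumes "inner_form h" "linear L" "inj L"
  shows "inner_form (\<lambda>v w. h (L v) (L w))"
proof -
  have "L v \<noteq> 0" if "v \<noteq> 0" for v
    using that assms(2,3) by (metis injD linear_0)
  then show ?thesis
    using assms(1,2) unfolding inner_form_def bilinear_def
    by (auto intro: linear_compose[unfolded o_def])
qed

text \<open>Gram-Schmidt by insertion. Only the expansions of the vectors in \<open>S\<close> are
  carried along, so no spans or dimensions enter.\<close>

lemma inner_form_expand_set:
  assumes h: "inner_form h" and "finite S"
  shows "\<exists>B. finite B \<and> (\<forall>b\<in>B. h b b = 1) \<and> (\<forall>b\<in>B. \<forall>c\<in>B. b \<noteq> c \<longrightarrow> h b c = 0) \<and>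
    (\<forall>v\<in>S. v = (\<Sum>b\<in>B. h v b *\<^sub>R b))"
  using \<open>finite S\<close>
proof induction
  case empty
  show ?case by (rule exI[of _ "{}"]) simp
next
  case (insert a S)
  then obtain B where B: "finite B" "\<forall>b\<in>B. h b b = 1" "\<forall>b\<in>B. \<forall>c\<in>B. b \<noteq> c \<longrightarrow> h b c = 0"
    "\<forall>v\<in>S. v = (\<Sum>b\<in>B. h v b *\<^sub>R b)" by blast
  have bil: "bilinear h" and hsym: "h u v = h v u" and pos: "v \<noteq> 0 \<Longrightarrow> 0 < h v v" for u v
    using h by (auto simp: inner_form_def)
  have linl: "linear (\<lambda>x. h x c)" and linr: "linear (h c)" for c
    using bil by (auto simp: bilinear_def)
  have sumB: "h (\<Sum>b\<in>B. t b *\<^sub>R b) c = (\<Sum>b\<in>B. t b * h b c)" for t c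
    by (simp add: linear_sum[OF linl] linear_cmul[OF linl])
  define a' where "a' = a - (\<Sum>b\<in>B. h a b *\<^sub>R b)"
  have orth: "h a' c = 0" if "c \<in> B" for c
  proof -
    have "h a' c = h a c - (\<Sum>b\<in>B. h a b * h b c)"
      by (simp add: a'_def linear_diff[OF linl] sumB)
    also have "(\<Sum>b\<in>B. h a b * h b c) = (\<Sum>b\<in>B. if b = c then h a c else 0)"
      using B(2,3) that by (intro sum.cong) auto
    also have "\<dots> = h a c" using B(1) that by simp
    finally show ?thesis by simp
  qed
  show ?case
  proof (cases "a' = 0")
    case True
    then have "a = (\<Sum>b\<in>B. h a b *\<^sub>R b)"
      unfolding a'_def by (rule eq_iff_diff_eq_0[THEN iffD2])
    with B show ?thesis by (intro exI[of _ B]) blast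
  next
    case False
    define c where "c = (1 / sqrt (h a' a')) *\<^sub>R a'"
    have hp: "h a' a' > 0" using pos False by simp
    have hc: "h u c = h u a' / sqrt (h a' a')" for u
      by (simp add: c_def linear_cmul[OF linr])
    have cc: "h c c = 1" using hp
      by (simp add: c_def linear_cmul[OF linr] linear_cmul[OF linl])
    have cB: "h b c = 0" if "b \<in> B" for b using orth[OF that] hsym hc by simp
    then have cB': "h c b = 0" if "b \<in> B" for b using hsym that by metis
    have "c \<notin> B" using cB cc by force
    \<comment> \<open>Earlier expansions survive: \<open>c\<close> is orthogonal to
      \<open>B\<close>, so \<open>h v c = 0\<close> and the new summand vanishes.\<close>
    have S: "v = (\<Sum>b\<in>insert c B. h v b *\<^sub>R b)" if "v \<in> S" for v
    proof -
      have v: "v = (\<Sum>b\<in>B. h v b *\<^sub>R b)" using B(4) that by blast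
      then have "h v c = h (\<Sum>b\<in>B. h v b *\<^sub>R b) c" by (rule arg_cong)
      also have "\<dots> = 0" unfolding sumB using cB by simp
      finally have "(\<Sum>b\<in>insert c B. h v b *\<^sub>R b) = (\<Sum>b\<in>B. h v b *\<^sub>R b)"
        using B(1) \<open>c \<notin> B\<close> by simp
      with v show ?thesis by (rule trans[OF _ sym])
    qed
    have "h a c *\<^sub>R c = a'"
    proof -
      have "a = a' + (\<Sum>b\<in>B. h a b *\<^sub>R b)" by (simp add: a'_def)
      then have "h a c = h (a' + (\<Sum>b\<in>B. h a b *\<^sub>R b)) c" by (rule arg_cong)
      also have "\<dots> = h a' c" using cB by (simp add: linear_add[OF linl] sumB)
      also have "\<dots> = sqrt (h a' a')" using hp by (simp add: hc real_div_sqrt)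
      finally show ?thesis using hp by (simp add: c_def)
    qed
    then have a: "(\<Sum>b\<in>insert c B. h a b *\<^sub>R b) = a"
      using B(1) \<open>c \<notin> B\<close> by (simp add: a'_def)
    have "\<forall>v\<in>insert a S. v = (\<Sum>b\<in>insert c B. h v b *\<^sub>R b)"
    proof
      fix v assume "v \<in> insert a S"
      then consider "v = a" | "v \<in> S" by blast
      then show "v = (\<Sum>b\<in>insert c B. h v b *\<^sub>R b)"
      proof cases
        case 1
        show ?thesis unfolding 1 by (rule a[symmetric])
      qed (rule S)
    qed
    moreover have "\<forall>b\<in>insert c B. \<forall>d\<in>insert c B. b \<noteq> d \<longrightarrow> h b d = 0"
      using B(3) cB cB' by auto
    moreover have "finite (insert c B)" "\<forall>b\<in>insert c B. h b b = 1"
      using B(1,2) cc by auto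
    ultimately show ?thesis by (intro exI[of _ "insert c B"] conjI)
  qed
qed

lemma inner_form_orthonormal_expansion:
  fixes h :: "'a::euclidean_space \<Rightarrow> 'a \<Rightarrow> real"
  assumes h: "inner_form h"
  obtains B where "finite B" "\<And>b. b \<in> B \<Longrightarrow> h b b = 1" "\<And>v. v = (\<Sum>b\<in>B. h v b *\<^sub>R b)"
proof -
  obtain B where B: "finite B" "\<forall>b\<in>B. h b b = 1" "\<forall>v\<in>Basis. v = (\<Sum>b\<in>B. h v b *\<^sub>R b)"
    using inner_form_expand_set[OF h finite_Basis] by blast
  have lin: "linear (\<lambda>x. h x c)" for c
    using h by (auto simp: inner_form_def bilinear_def)
  have "linear (\<lambda>v. \<Sum>b\<in>B. h v b *\<^sub>R b)"
    by (simp add: linear_iff linear_add[OF lin] linear_cmul[OF lin] sum.distrib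
        scaleR_add_left scaleR_sum_right)
  then have "id v = (\<Sum>b\<in>B. h v b *\<^sub>R b)" for v
    by (rule linear_eq_on[OF linear_id, of _ _ Basis])
      (simp, unfold id_apply, erule bspec[OF B(3)])
  then have "v = (\<Sum>b\<in>B. h v b *\<^sub>R b)" for v
    unfolding id_apply .
  from that[OF B(1) bspec[OF B(2)] this] show ?thesis .
qed

lemma inner_form_eqI:
  assumes h: "inner_form h" and "\<And>y. h w y = h w' y"
  shows "w = w'"
proof -
  have lin: "linear (\<lambda>x. h x c)" for c
    using h by (auto simp: inner_form_def bilinear_def)
  have "h (w - w') (w - w') = 0" using assms(2) by (simp add: linear_diff[OF lin])
  moreover have "v \<noteq> 0 \<Longrightarrow> 0 < h v v" for v using h by (simp add: inner_form_def)
  ultimately show ?thesis by (metis eq_iff_diff_eq_0 less_irrefl)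
qed

text \<open>The representing vector is the sum of \<open>\<phi> b *\<^sub>R b\<close> over an
  \<open>h\<close>-orthonormal system. This is what makes the Koszul description in
  \<open>christoffel\<close> meaningful.\<close>

lemma inner_form_riesz:
  assumes h: "inner_form h" and phi: "linear \<phi>"
  shows "\<exists>!w. \<forall>y. h w y = \<phi> y"
proof -
  obtain B where B: "\<And>v. v = (\<Sum>b\<in>B. h v b *\<^sub>R b)"
    by (rule inner_form_orthonormal_expansion[OF h], rule that)
  have linl: "linear (\<lambda>x. h x c)" and hsym: "h u v = h v u" for c u v
    using h by (auto simp: inner_form_def bilinear_def)
  have "h (\<Sum>b\<in>B. \<phi> b *\<^sub>R b) y = \<phi> y" for y
  proof -
    have "h (\<Sum>b\<in>B. \<phi> b *\<^sub>R b) y = (\<Sum>b\<in>B. h y b * \<phi> b)"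
      by (simp add: linear_sum[OF linl] linear_cmul[OF linl] hsym[of y] mult.commute)
    also have "\<dots> = \<phi> (\<Sum>b\<in>B. h y b *\<^sub>R b)"
      by (simp add: linear_sum[OF phi] linear_cmul[OF phi])
    also have "\<dots> = \<phi> y" by (rule arg_cong[OF B[symmetric]])
    finally show ?thesis .
  qed
  then show ?thesis using inner_form_eqI[OF h] by (metis (no_types))
qed

text \<open>The trace does not depend on the basis: expanding the columns of the matrix in an
  \<open>h\<close>-orthonormal system turns the coordinate diagonal into the sum of all
  \<open>h (A b) b\<close>.\<close>

lemma trace_neg_of_neg_definite:
  fixes A :: "real^'m::finite \<Rightarrow> real^'m"
  assumes h: "inner_form h" and A: "linear A" and neg: "\<And>v. v \<noteq> 0 \<Longrightarrow> h (A v) v < 0"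
  shows "trace (matrix A) < 0"
proof -
  obtain B where B: "finite B" "\<And>b. b \<in> B \<Longrightarrow> h b b = 1" "\<And>v. v = (\<Sum>b\<in>B. h v b *\<^sub>R b)"
    by (rule inner_form_orthonormal_expansion[OF h], rule that)
  have lin: "linear (\<lambda>x. h (A x) c)" for c
    using h linear_compose[OF A, of "\<lambda>x. h x c"] by (auto simp: inner_form_def bilinear_def o_def)
  have lin0: "linear (\<lambda>x. h x c)" for c
    using h by (auto simp: inner_form_def bilinear_def)
  have "trace (matrix A) = (\<Sum>i\<in>UNIV. A (axis i 1) $ i)"
    by (simp add: trace_def matrix_def)
  also have "\<dots> = (\<Sum>i\<in>UNIV. \<Sum>b\<in>B. h (A (axis i 1)) b * b $ i)"
  proof (rule sum.cong[OF refl])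
    fix i
    show "A (axis i 1) $ i = (\<Sum>b\<in>B. h (A (axis i 1)) b * b $ i)"
      using arg_cong[OF B(3)[of "A (axis i 1)"], of "\<lambda>v. v $ i"] by simp
  qed
  also have "\<dots> = (\<Sum>b\<in>B. \<Sum>i\<in>UNIV. b $ i * h (A (axis i 1)) b)"
    by (subst sum.swap) (simp add: mult.commute)
  also have "\<dots> = (\<Sum>b\<in>B. h (A b) b)"
  proof (rule sum.cong[OF refl])
    fix b
    have "(\<Sum>i\<in>UNIV. b $ i * h (A (axis i 1)) b) = h (A (\<Sum>i\<in>UNIV. b $ i *\<^sub>R axis i 1)) b"
      by (simp add: linear_sum[OF lin] linear_cmul[OF lin])
    also have "(\<Sum>i\<in>UNIV. b $ i *\<^sub>R axis i 1) = b"
      using basis_expansion[of b] by (simp add: scalar_mult_eq_scaleR)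
    finally show "(\<Sum>i\<in>UNIV. b $ i * h (A (axis i 1)) b) = h (A b) b" .
  qed
  also have "\<dots> < 0"
  proof -
    \<comment> \<open>An empty system would expand the nonzero vector \<open>1\<close> to
      \<open>0\<close>; a strict inequality of sums needs a summand.\<close>
    have "B \<noteq> {}" using B(3)[of 1] by (metis sum.empty zero_neq_one)
    moreover have "h (A b) b < 0" if "b \<in> B" for b
      using neg[of b] B(2)[OF that] linear_0[OF lin0, of b] by (cases "b = 0") auto
    ultimately show ?thesis using B(1) sum_strict_mono[of B "\<lambda>b. h (A b) b" "\<lambda>_. 0"] by simp
  qed
  finally show ?thesis .
qed

text \<open>A positive second derivative at a critical point makes \<open>\<phi>'\<close> positive
  just to the right of it, and the mean value theorem then produces a value above the
  maximum.\<close>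

lemma interior_max_second_derivative:
  fixes \<phi> \<phi>' :: "real \<Rightarrow> real"
  assumes e: "0 < e"
    and d: "\<And>t. \<bar>t\<bar> < e \<Longrightarrow> (\<phi> has_real_derivative \<phi>' t) (at t)"
    and d2: "(\<phi>' has_real_derivative c) (at 0)"
    and mx: "\<And>t. \<bar>t\<bar> < e \<Longrightarrow> \<phi> t \<le> \<phi> 0"
  shows "\<phi>' 0 = 0" "c \<le> 0"
proof -
  show z: "\<phi>' 0 = 0"
    using DERIV_local_max[of \<phi> "\<phi>' 0" 0 e] e d[of 0] mx by auto
  show "c \<le> 0"
  proof (rule ccontr)
    assume "\<not> c \<le> 0"
    then obtain \<delta> where \<delta>: "0 < \<delta>" "\<And>t. 0 < t \<Longrightarrow> t < \<delta> \<Longrightarrow> 0 < \<phi>' t"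
      using DERIV_pos_inc_right[OF d2] z by auto
    define t where "t = min e \<delta> / 2"
    have t: "0 < t" "t < e" "t < \<delta>" using e \<delta>(1) by (auto simp: t_def)
    obtain s where s: "0 < s" "s < t" "\<phi> t - \<phi> 0 = (t - 0) * \<phi>' s"
      using MVT2[OF t(1), of \<phi> \<phi>'] d t by auto
    have "0 < t * \<phi>' s" using t s \<delta>(2) by simp
    with s(3) mx[of t] t show False by simp
  qed
qed

section \<open>The metric of complex hyperbolic space\<close>

text \<open>The complex structure as a real linear map, skew for the real inner product; with it the
  Hermitian metric can be differentiated by real calculus.\<close>

definition mult_i :: "complex^'n \<Rightarrow> complex^'n" where
  "mult_i z = (\<chi> i. \<i> * z $ i)"

lemma linear_mult_i: "linear mult_i"
  by (auto simp: linear_iff mult_i_def vec_eq_iff algebra_simps)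

lemma bounded_linear_mult_i: "bounded_linear mult_i"
  by (rule linear_conv_bounded_linear[THEN iffD1, OF linear_mult_i])

lemma inner_mult_i_left: "mult_i u \<bullet> v = - (u \<bullet> mult_i (v :: complex^'n))"
  by (simp add: mult_i_def inner_vec_def inner_complex_def sum_negf[symmetric] algebra_simps)

lemma inner_mult_i_self: "u \<bullet> mult_i (u :: complex^'n) = 0"
  using inner_mult_i_left[of u u] by (simp add: inner_commute)

lemma hermitian_eq: "hermitian u v = Complex (u \<bullet> v) (u \<bullet> mult_i v)"
  by (simp add: complex_eq_iff hermitian_def inner_vec_def inner_complex_def mult_i_def
      algebra_simps sum.distrib sum_subtractf)

text \<open>Skewness of \<open>mult_i\<close> turns the minus sign in the real part of a complex
  product into a plus, so the second summand is visibly nonnegative for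
  \<open>u = v\<close>.\<close>

lemma CH_metric_eq:
  "CH_metric z u v = (u \<bullet> v) * inverse (1 - z \<bullet> z)
     + ((u \<bullet> z) * (v \<bullet> z) + (u \<bullet> mult_i z) * (v \<bullet> mult_i z)) * (inverse (1 - z \<bullet> z))\<^sup>2"
proof -
  have "z \<bullet> mult_i v = - (v \<bullet> mult_i z)"
    using inner_mult_i_left[of z v] by (simp add: inner_commute)
  then show ?thesis
    by (simp add: CH_metric_def hermitian_eq power2_norm_eq_inner Re_divide_of_real
        del: of_real_power of_real_diff)
       (simp add: divide_inverse power_inverse inner_commute)
qed

text \<open>The derivative of \<open>\<lambda>p. CH_metric p u v\<close> at \<open>z\<close> in direction \<open>w\<close>.\<close>

definition CH_metric_deriv ::
  "complex^'n \<Rightarrow> complex^'n \<Rightarrow> complex^'n \<Rightarrow> complex^'n \<Rightarrow> real" where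
  "CH_metric_deriv z w u v =
     2 * (z \<bullet> w) * (u \<bullet> v) * (inverse (1 - z \<bullet> z))\<^sup>2
     + ((u \<bullet> w) * (v \<bullet> z) + (u \<bullet> z) * (v \<bullet> w)
        + (u \<bullet> mult_i w) * (v \<bullet> mult_i z) + (u \<bullet> mult_i z) * (v \<bullet> mult_i w)) * (inverse (1 - z \<bullet> z))\<^sup>2
     + 4 * (z \<bullet> w) * ((u \<bullet> z) * (v \<bullet> z) + (u \<bullet> mult_i z) * (v \<bullet> mult_i z)) * (inverse (1 - z \<bullet> z))^3"

lemma CH_ball_inner: "z \<in> CH_ball \<longleftrightarrow> z \<bullet> z < 1"
  by (simp add: CH_ball_def dot_square_norm abs_square_less_1)

text \<open>Base point and both vectors move. Constant vectors give the Koszul terms; moving ones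
  allow the equations of a unit normal to be differentiated along an immersion.\<close>

lemma has_derivative_CH_metric:
  fixes r u v :: "'d::real_normed_vector \<Rightarrow> complex^'n"
  assumes z: "r x \<in> CH_ball"
    and r: "(r has_derivative r') (at x)"
    and u: "(u has_derivative u') (at x)"
    and v: "(v has_derivative v') (at x)"
  shows "((\<lambda>y. CH_metric (r y) (u y) (v y)) has_derivative
    (\<lambda>w. CH_metric_deriv (r x) (r' w) (u x) (v x)
        + CH_metric (r x) (u' w) (v x) + CH_metric (r x) (u x) (v' w))) (at x)"
proof -
  note J = bounded_linear.has_derivative[OF bounded_linear_mult_i]
  define q where "q = inverse (1 - r x \<bullet> r x)"
  have q: "((\<lambda>y. inverse (1 - r y \<bullet> r y)) has_derivative (\<lambda>w. 2 * (r x \<bullet> r' w) * q\<^sup>2)) (at x)"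
    using z
    by (auto intro!: derivative_eq_intros r
        simp: CH_ball_inner inner_commute q_def power2_eq_square algebra_simps)
  have q2: "((\<lambda>y. (inverse (1 - r y \<bullet> r y))\<^sup>2) has_derivative (\<lambda>w. 4 * (r x \<bullet> r' w) * q^3)) (at x)"
    unfolding power2_eq_square
    by (rule has_derivative_eq_rhs[OF has_derivative_mult[OF q q]])
      (simp add: q_def[symmetric] power2_eq_square power3_eq_cube algebra_simps)
  have uv: "((\<lambda>y. a y \<bullet> b y) has_derivative (\<lambda>w. a x \<bullet> b' w + a' w \<bullet> b x)) (at x)"
    if "(a has_derivative a') (at x)" "(b has_derivative b') (at x)" for a b :: "'d \<Rightarrow> complex^'n" and a' b'
    using that by (rule has_derivative_inner)
  show ?thesis
    unfolding CH_metric_eq CH_metric_deriv_def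
    by (rule has_derivative_eq_rhs[OF has_derivative_add[OF
          has_derivative_mult[OF uv[OF u v] q]
          has_derivative_mult[OF has_derivative_add[OF
             has_derivative_mult[OF uv[OF u r] uv[OF v r]]
             has_derivative_mult[OF uv[OF u J[OF r]] uv[OF v J[OF r]]]] q2]]])
      (simp add: q_def[symmetric] algebra_simps)
qed

lemma inner_form_CH_metric:
  assumes "z \<in> CH_ball"
  shows "inner_form (CH_metric z)"
proof -
  have q: "0 < inverse (1 - z \<bullet> z)" using assms by (simp add: CH_ball_inner)
  have "linear (\<lambda>u. CH_metric z u v)" "linear (CH_metric z v)" for v
    by (auto simp: linear_iff CH_metric_eq algebra_simps)
  moreover have "CH_metric z u v = CH_metric z v u" for u v
    by (simp add: CH_metric_eq inner_commute mult.commute)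
  moreover have "0 < CH_metric z v v" if "v \<noteq> 0" for v
    unfolding CH_metric_eq using that q by (intro add_pos_nonneg mult_pos_pos mult_nonneg_nonneg) auto
  ultimately show ?thesis by (auto simp: inner_form_def bilinear_def)
qed

lemma smooth_on_CH_metric:
  assumes S: "open S" and "smooth_on S r" "smooth_on S u" "smooth_on S v"
    and ball: "r ` S \<subseteq> CH_ball"
  shows "smooth_on S (\<lambda>y. CH_metric (r y) (u y) (v y))"
proof -
  have pos: "0 < 1 - r y \<bullet> r y" if "y \<in> S" for y
    using ball that by (auto simp: CH_ball_inner)
  have "smooth_on S (\<lambda>y. (1 - r y \<bullet> r y) powr - 1)"
    by (intro smooth_on_powr S smooth_on_diff smooth_on_inner smooth_on_const assms pos)
  then have "smooth_on S (\<lambda>y. inverse (1 - r y \<bullet> r y))"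
    by (rule smooth_on_cong[OF S, rotated]) (use pos in \<open>fastforce simp: powr_minus\<close>)
  then show ?thesis
    unfolding CH_metric_eq power2_eq_square
    by (intro smooth_on_add smooth_on_mult smooth_on_inner smooth_on_bounded_linear[OF S bounded_linear_mult_i]
        S assms)
qed

lemma frechet_derivative_CH_metric:
  assumes "z \<in> CH_ball"
  shows "frechet_derivative (\<lambda>p. CH_metric p u v) (at z) w = CH_metric_deriv z w u v"
proof -
  have "CH_metric z 0 v = 0" "CH_metric z u 0 = 0" by (auto simp: CH_metric_eq)
  then have "((\<lambda>p. CH_metric p u v) has_derivative (\<lambda>w. CH_metric_deriv z w u v)) (at z)"
    using has_derivative_CH_metric[of "\<lambda>p. p" z "\<lambda>w. w" "\<lambda>_. u" "\<lambda>_. 0" "\<lambda>_. v" "\<lambda>_. 0"] assms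
    by simp
  then show ?thesis by (metis frechet_derivative_at)
qed

lemma linear_CH_metric_deriv:
  "linear (\<lambda>w. CH_metric_deriv z w u v)" "linear (CH_metric_deriv z w u)"
  by (auto simp: linear_iff CH_metric_deriv_def algebra_simps
      linear_add[OF linear_mult_i] linear_cmul[OF linear_mult_i])

lemma CH_metric_deriv_commute: "CH_metric_deriv z w u v = CH_metric_deriv z w v u"
  by (simp add: CH_metric_deriv_def inner_commute algebra_simps)

text \<open>The right side is linear in \<open>y\<close>, so Riesz representation supplies the
  unique vector that \<open>THE\<close> asks for.\<close>

lemma christoffel_CH_metric:
  assumes z: "z \<in> CH_ball"
  shows "2 * CH_metric z (christoffel CH_metric z u v) y =
    CH_metric_deriv z u v y + CH_metric_deriv z v u y - CH_metric_deriv z y u v"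
proof -
  let ?K = "\<lambda>y. CH_metric_deriv z u v y + CH_metric_deriv z v u y - CH_metric_deriv z y u v"
  have "linear (\<lambda>y. ?K y / 2)"
    by (simp add: linear_iff algebra_simps add_divide_distrib diff_divide_distrib
        linear_add[OF linear_CH_metric_deriv(1)] linear_cmul[OF linear_CH_metric_deriv(1)]
        linear_add[OF linear_CH_metric_deriv(2)] linear_cmul[OF linear_CH_metric_deriv(2)])
  from inner_form_riesz[OF inner_form_CH_metric[OF z] this]
  have "\<exists>!w. \<forall>y. 2 * CH_metric z w y = ?K y"
    by (simp add: field_simps)
  from theI'[OF this] show ?thesis
    unfolding christoffel_def frechet_derivative_CH_metric[OF z] by blast
qed

section \<open>Unit normal fields\<close>

definition gram :: "('a \<Rightarrow> 'a \<Rightarrow> real) \<Rightarrow> ('m \<Rightarrow> 'a) \<Rightarrow> real^'m^'m" where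
  "gram h e = (\<chi> i j. h (e i) (e j))"

text \<open>By Cramer's rule, a positive multiple of the component of \<open>z\<close> orthogonal to all \<open>e i\<close>,
  depending polynomially on the values of \<open>h\<close> and on the vectors.\<close>

definition gram_normal ::
  "('a::euclidean_space \<Rightarrow> 'a \<Rightarrow> real) \<Rightarrow> ('m::finite \<Rightarrow> 'a) \<Rightarrow> 'a \<Rightarrow> 'a" where
  "gram_normal h e z = det (gram h e) *\<^sub>R (det (gram h e) *\<^sub>R z -
     (\<Sum>k\<in>UNIV. det ((\<chi> i j. if j = k then h (e i) z else h (e i) (e j)) :: real^'m^'m) *\<^sub>R e k))"

text \<open>A kernel vector of the Gram matrix gives a combination of the \<open>e i\<close> that is
  \<open>h\<close>-orthogonal to each of them, hence to itself.\<close>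

lemma det_gram_nonzero:
  assumes h: "inner_form h" and e: "\<And>v. (\<Sum>i\<in>UNIV. v $ i *\<^sub>R e i) = 0 \<Longrightarrow> v = 0"
  shows "det (gram h e :: real^'m::finite^'m) \<noteq> 0"
proof -
  have lin: "linear (h c)" "linear (\<lambda>x. h x c)" for c
    using h by (auto simp: inner_form_def bilinear_def)
  have "v = 0" if "gram h e *v v = 0" for v :: "real^'m"
  proof (rule e)
    have "h (e i) (\<Sum>j\<in>UNIV. v $ j *\<^sub>R e j) = 0" for i
      using that by (simp add: vec_eq_iff gram_def matrix_vector_mult_def linear_sum[OF lin(1)]
          linear_cmul[OF lin(1)] mult.commute)
    then have "h (\<Sum>j\<in>UNIV. v $ j *\<^sub>R e j) (\<Sum>j\<in>UNIV. v $ j *\<^sub>R e j) = 0"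
      by (subst linear_sum[OF lin(2)]) (simp add: linear_cmul[OF lin(2)])
    then show "(\<Sum>j\<in>UNIV. v $ j *\<^sub>R e j) = 0"
      using h unfolding inner_form_def by (metis less_irrefl)
  qed
  then have "invertible (gram h e)"
    using matrix_left_invertible_ker invertible_left_inverse by metis
  then show ?thesis by (simp add: invertible_det_nz)
qed

lemma gram_normal_orthogonal:
  assumes h: "inner_form h" and e: "\<And>v. (\<Sum>i\<in>UNIV. v $ i *\<^sub>R e i) = 0 \<Longrightarrow> v = 0"
  shows "h (gram_normal h e z) (e (j :: 'm::finite)) = 0"
proof -
  have lin: "linear (h c)" "linear (\<lambda>x. h x c)" and hsym: "h u v = h v u" for c u v
    using h by (auto simp: inner_form_def bilinear_def)
  let ?d = "det (gram h e :: real^'m^'m)"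
  let ?D = "\<lambda>k. det ((\<chi> i j. if j = k then h (e i) z else h (e i) (e j)) :: real^'m^'m)"
  have d: "?d \<noteq> 0" using det_gram_nonzero[OF h e] by blast
  have D: "(\<chi> i j. if j = k then (\<chi> i. h (e i) z) $ i else gram h e $ i $ j) =
      ((\<chi> i j. if j = k then h (e i) z else h (e i) (e j)) :: real^'m^'m)" for k
    by (simp add: vec_eq_iff gram_def)
  \<comment> \<open>The quotients \<open>?D k / ?d\<close> solve the normal equations: they are the
    coefficients of the \<open>h\<close>-projection of \<open>z\<close> onto the span of the
    \<open>e i\<close>.\<close>
  have "gram h e *v (\<chi> k. ?D k / ?d) = (\<chi> i. h (e i) z)"
    using cramer[OF d, of "\<chi> k. ?D k / ?d" "\<chi> i. h (e i) z"] unfolding D by simp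
  then have "(\<Sum>k\<in>UNIV. h (e j) (e k) * (?D k / ?d)) = h (e j) z"
    by (simp add: vec_eq_iff gram_def matrix_vector_mult_def)
  then have "(\<Sum>k\<in>UNIV. ?D k * h (e j) (e k)) = ?d * h (e j) z"
    using d by (simp add: sum_divide_distrib[symmetric] field_simps)
  then show ?thesis
    unfolding gram_normal_def hsym[of _ "e j"]
    by (simp add: linear_cmul[OF lin(1)] linear_diff[OF lin(1)] linear_sum[OF lin(1)])
qed

text \<open>Every Cramer numerator has a zero column. The outer determinant factor in
  \<open>gram_normal\<close> makes the coefficient a square, hence positive whatever the sign of the
  determinant.\<close>

lemma gram_normal_of_orthogonal:
  assumes h: "inner_form h" and z: "\<And>i. h z (e i) = 0"
  shows "gram_normal h e z = (det (gram h e :: real^'m::finite^'m))\<^sup>2 *\<^sub>R z"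
proof -
  have "h (e i) z = 0" for i using h z by (simp add: inner_form_def)
  then have "column k ((\<chi> i j. if j = k then h (e i) z else h (e i) (e j)) :: real^'m^'m) = 0" for k
    by (simp add: column_def vec_eq_iff)
  then have "det ((\<chi> i j. if j = k then h (e i) z else h (e i) (e j)) :: real^'m^'m) = 0" for k
    by (rule det_zero_column)
  then show ?thesis by (simp add: gram_normal_def power2_eq_square)
qed

lemma smooth_on_gram_normal:
  assumes S: "open S" and r: "smooth_on S r" "r ` S \<subseteq> CH_ball" and e: "\<And>i. smooth_on S (e i)"
  shows "smooth_on S (\<lambda>y. gram_normal (CH_metric (r y)) (\<lambda>i::'m::finite. e i y) z)"
proof -
  have g: "smooth_on S (\<lambda>y. CH_metric (r y) (e i y) (e j y))"
    "smooth_on S (\<lambda>y. CH_metric (r y) (e i y) z)" for i j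
    by (intro smooth_on_CH_metric S r e smooth_on_const)+
  have "smooth_on S (\<lambda>y. det (\<chi> i j. if j = k then CH_metric (r y) (e i y) z
      else CH_metric (r y) (e i y) (e j y)))" for k
  proof (rule smooth_on_det[OF S])
    show "smooth_on S (\<lambda>y. (\<chi> i j. if j = k then CH_metric (r y) (e i y) z
      else CH_metric (r y) (e i y) (e j y)) $ i $ j)" for i j
      by (cases "j = k") (simp_all add: g)
  qed
  moreover have "smooth_on S (\<lambda>y. det (gram (CH_metric (r y)) (\<lambda>i. e i y)))"
    by (rule smooth_on_det[OF S]) (simp add: gram_def g)
  ultimately show ?thesis
    unfolding gram_normal_def
    by (intro smooth_on_scaleR smooth_on_diff smooth_on_sum smooth_on_const S e)
qed

text \<open>The fixed vector \<open>z\<close> is known to be normal only at \<open>y0\<close>.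
  Projecting it off the moving tangent spaces gives a normal field, nonzero near \<open>y0\<close>
  by continuity and then normalized. At \<open>y0\<close> itself only the length of \<open>z\<close>
  changes, so the orientation is prescribed.\<close>

lemma unit_normal_field_exists:
  fixes r :: "real^'m::finite \<Rightarrow> complex^'n"
  assumes S: "open S" and r: "smooth_on S r" "r ` S \<subseteq> CH_ball"
    and inj: "\<And>y. y \<in> S \<Longrightarrow> inj (frechet_derivative r (at y))"
    and y0: "y0 \<in> S" and z: "z \<noteq> 0"
    and orth: "\<And>v. CH_metric (r y0) z (frechet_derivative r (at y0) v) = 0"
  obtains V N c where "open V" "y0 \<in> V" "V \<subseteq> S" "unit_normal_field CH_metric r V N"
    "0 < c" "N y0 = c *\<^sub>R z"
proof -
  define e where "e i y = frechet_derivative r (at y) (axis i 1)" for i y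
  define \<xi> where "\<xi> y = gram_normal (CH_metric (r y)) (\<lambda>i. e i y) z" for y
  define \<rho> where "\<rho> y = CH_metric (r y) (\<xi> y) (\<xi> y)" for y
  define N where "N y = \<rho> y powr (-1/2) *\<^sub>R \<xi> y" for y
  define V where "V = S \<inter> \<rho> -` {0<..}"
  have form: "inner_form (CH_metric (r y))" if "y \<in> S" for y
    using r(2) that by (intro inner_form_CH_metric) auto
  have lin: "linear (frechet_derivative r (at y))" if "y \<in> S" for y
    using smooth_on_has_derivative[OF S r(1) that] by (rule has_derivative_linear)
  have dr: "frechet_derivative r (at y) v = (\<Sum>i\<in>UNIV. v $ i *\<^sub>R e i y)" if "y \<in> S" for v y
  proof -
    have "frechet_derivative r (at y) v = frechet_derivative r (at y) (\<Sum>i\<in>UNIV. v $ i *\<^sub>R axis i 1)"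
      using basis_expansion[of v] by (simp add: scalar_mult_eq_scaleR)
    then show ?thesis
      by (simp add: linear_sum[OF lin[OF that]] linear_cmul[OF lin[OF that]] e_def)
  qed
  have ind: "v = 0" if "y \<in> S" "(\<Sum>i\<in>UNIV. v $ i *\<^sub>R e i y) = 0" for v y
    using that inj[OF that(1)] dr[OF that(1)] linear_0[OF lin[OF that(1)]] by (metis injD)
  have "smooth_on S (e i)" for i
    unfolding e_def using smooth_on_directional_derivative[OF r(1)] .
  then have \<xi>: "smooth_on S \<xi>"
    unfolding \<xi>_def by (intro smooth_on_gram_normal S r)
  then have \<rho>: "smooth_on S \<rho>"
    unfolding \<rho>_def by (intro smooth_on_CH_metric S r)
  have V: "open V"
    unfolding V_def
    by (intro continuous_open_preimage smooth_on_imp_continuous_on \<rho> S open_greaterThan)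
  have VS: "V \<subseteq> S" by (auto simp: V_def)
  define c0 where "c0 = (det (gram (CH_metric (r y0)) (\<lambda>i. e i y0)))\<^sup>2"
  have \<xi>0: "\<xi> y0 = c0 *\<^sub>R z"
    unfolding \<xi>_def c0_def by (rule gram_normal_of_orthogonal[OF form[OF y0]]) (simp add: e_def orth)
  have c0: "0 < c0"
    unfolding c0_def using det_gram_nonzero[OF form[OF y0], of "\<lambda>i. e i y0"] ind[OF y0] by simp
  have \<rho>0: "0 < \<rho> y0"
    using form[OF y0] c0 z by (simp add: \<rho>_def \<xi>0 inner_form_def)
  have "unit_normal_field CH_metric r V N"
    unfolding unit_normal_field_def
  proof (intro conjI ballI allI)
    show "smooth_on V N"
      unfolding N_def
      by (intro smooth_on_scaleR smooth_on_powr V smooth_on_subset[OF \<xi> VS] smooth_on_subset[OF \<rho> VS])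
        (auto simp: V_def)
    fix y assume y: "y \<in> V"
    then have yS: "y \<in> S" and pos: "0 < \<rho> y" by (auto simp: V_def)
    have lin: "linear (CH_metric (r y) u)" "linear (\<lambda>x. CH_metric (r y) x u)" for u
      using form[OF yS] by (auto simp: inner_form_def bilinear_def)
    have "CH_metric (r y) (N y) (N y) = \<rho> y powr (-1/2) * \<rho> y powr (-1/2) * \<rho> y"
      by (simp add: N_def \<rho>_def linear_cmul[OF lin(1)] linear_cmul[OF lin(2)])
    also have "\<dots> = \<rho> y powr (-1/2 + -1/2) * \<rho> y" by (simp only: powr_add)
    also have "\<dots> = 1" using pos by (simp add: powr_minus)
    finally show "CH_metric (r y) (N y) (N y) = 1" .
    show "CH_metric (r y) (N y) (frechet_derivative r (at y) v) = 0" for v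
      using gram_normal_orthogonal[OF form[OF yS], of "\<lambda>i. e i y"] ind[OF yS]
      by (simp add: dr[OF yS] N_def \<xi>_def linear_sum[OF lin(1)] linear_cmul[OF lin(1)] linear_cmul[OF lin(2)])
  qed
  then show ?thesis
    using that[OF V _ VS, of N "\<rho> y0 powr (-1/2) * c0"] y0 \<rho>0 c0
    by (simp add: V_def N_def \<xi>0)
qed

section \<open>The shape operator\<close>

text \<open>The range lies in the hyperplane orthogonal to \<open>n\<close>, and injectivity gives
  both the same dimension.\<close>

lemma range_eq_orthogonal_complement:
  fixes L :: "'d::euclidean_space \<Rightarrow> 'a::euclidean_space"
  assumes h: "inner_form h" and L: "linear L" "inj L" and dim: "DIM('d) + 1 = DIM('a)"
    and n: "n \<noteq> 0" "\<And>v. h n (L v) = 0"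
  shows "range L = {x. h n x = 0}"
proof -
  have lin: "linear (h n)" and pos: "0 < h n n"
    using h n(1) by (auto simp: inner_form_def bilinear_def)
  have "inner_form (\<lambda>x y :: 'a. x \<bullet> y)"
    by (auto simp: inner_form_def inner_commute bilinear_def linear_iff inner_left_distrib inner_right_distrib)
  from inner_form_riesz[OF this lin] obtain m where m: "\<And>x. m \<bullet> x = h n x" by blast
  have "m \<noteq> 0" using m[of n] pos by auto
  then have "dim {x. h n x = 0} = DIM('a) - 1"
    using dim_hyperplane[of m] by (simp add: m)
  moreover have "dim (range L) = DIM('d)"
    using dim_image_eq[OF L(1), of UNIV] L(2) by simp
  moreover have "subspace {x. h n x = 0}"
    using subspace_hyperplane[of m] by (simp add: m)
  moreover have "subspace (range L)"
    using L(1) by (simp add: linear_subspace_image)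
  ultimately show ?thesis
    using dim n(2) by (intro subspace_dim_equal) auto
qed

text \<open>The second claim is g(AX, X) = g(N, \<nabla>X X) in coordinates: differentiating the
  orthogonality of \<open>N\<close> to the tangent vectors moves the derivative onto the immersion,
  and Koszul's formula replaces Christoffel symbols by derivatives of the metric.\<close>

lemma shape_operator_CH_metric:
  fixes r :: "real^'m::finite \<Rightarrow> complex^'n"
  assumes V: "open V" "y \<in> V" and r: "smooth_on V r" "r ` V \<subseteq> CH_ball"
    and inj: "inj (frechet_derivative r (at y))"
    and N: "unit_normal_field CH_metric r V N"
    and dim: "CARD('m) + 1 = 2 * CARD('n)"
  defines "A \<equiv> shape_operator CH_metric r N y"
  shows "linear A"
    and "CH_metric (r y) (frechet_derivative r (at y) (A v)) (frechet_derivative r (at y) v) =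
      CH_metric_deriv (r y) (frechet_derivative r (at y) v) (N y) (frechet_derivative r (at y) v)
      + CH_metric (r y) (N y) (frechet_derivative (\<lambda>x. frechet_derivative r (at x) v) (at y) v)
      - CH_metric_deriv (r y) (N y) (frechet_derivative r (at y) v) (frechet_derivative r (at y) v) / 2"
proof -
  define D where "D = frechet_derivative r (at y)"
  define DN where "DN = frechet_derivative N (at y)"
  define g where "g = CH_metric (r y)"
  define \<Gamma> where "\<Gamma> = christoffel CH_metric (r y)"
  define G where "G w = DN w + \<Gamma> (D w) (N y)" for w
  have ball: "r y \<in> CH_ball" using r(2) V(2) by auto
  have form: "inner_form g" unfolding g_def by (rule inner_form_CH_metric[OF ball])
  have gl: "linear (\<lambda>x. g x u)" and gsym: "g u w = g w u" for u w
    using form by (auto simp: inner_form_def bilinear_def)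
  have dr: "(r has_derivative D) (at y)"
    unfolding D_def by (rule smooth_on_has_derivative[OF V(1) r(1) V(2)])
  have N': "smooth_on V N" "\<And>x. x \<in> V \<Longrightarrow> CH_metric (r x) (N x) (N x) = 1"
    "\<And>x w. x \<in> V \<Longrightarrow> CH_metric (r x) (N x) (frechet_derivative r (at x) w) = 0"
    using N by (auto simp: unit_normal_field_def)
  have dN: "(N has_derivative DN) (at y)"
    unfolding DN_def by (rule smooth_on_has_derivative[OF V(1) N'(1) V(2)])
  have d2: "((\<lambda>x. frechet_derivative r (at x) w) has_derivative
      frechet_derivative (\<lambda>x. frechet_derivative r (at x) w) (at y)) (at y)" for w
    by (rule smooth_on_has_derivative[OF V(1) smooth_on_directional_derivative[OF r(1)] V(2)])
  have linD: "linear D" and linDN: "linear DN"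
    using dr dN by (auto intro: has_derivative_linear)
  have const: "F w = 0" if "(f has_derivative F) (at y)" "\<And>x. x \<in> V \<Longrightarrow> f x = c"
    for f :: "real^'m \<Rightarrow> real" and F c w
  proof -
    have "((\<lambda>_. c) has_derivative F) (at y)"
      by (rule has_derivative_transform_within_open[OF that(1) V that(2)])
    from has_derivative_unique[OF this has_derivative_const] show ?thesis by simp
  qed
  have \<Gamma>: "2 * g (\<Gamma> u v) w = CH_metric_deriv (r y) u v w + CH_metric_deriv (r y) v u w
      - CH_metric_deriv (r y) w u v" for u v w
    unfolding g_def \<Gamma>_def by (rule christoffel_CH_metric[OF ball])
  \<comment> \<open>Differentiating |N|^2 = 1 shows that the covariant derivative of
    \<open>N\<close> is tangent. With \<open>N y\<close> in two slots, two of the three Koszul terms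
    cancel.\<close>
  have G_N: "g (G w) (N y) = 0" for w
  proof -
    have "CH_metric_deriv (r y) (D w) (N y) (N y) + g (DN w) (N y) + g (N y) (DN w) = 0"
      unfolding g_def by (rule const[OF has_derivative_CH_metric[OF ball dr dN dN] N'(2)])
    then show ?thesis
      using \<Gamma>[of "D w" "N y" "N y"] gsym[of "N y" "DN w"] by (simp add: G_def linear_add[OF gl])
  qed
  \<comment> \<open>Here orthogonality is differentiated. The two Koszul terms along
    \<open>D w\<close> cancel by symmetry, leaving half a derivative along
    \<open>N y\<close>.\<close>
  have G_D: "g (G w) (D w) = - CH_metric_deriv (r y) (D w) (N y) (D w)
      - g (N y) (frechet_derivative (\<lambda>x. frechet_derivative r (at x) w) (at y) w)
      + CH_metric_deriv (r y) (N y) (D w) (D w) / 2" for w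
  proof -
    have "CH_metric_deriv (r y) (D w) (N y) (frechet_derivative r (at y) w)
        + g (DN w) (frechet_derivative r (at y) w)
        + g (N y) (frechet_derivative (\<lambda>x. frechet_derivative r (at x) w) (at y) w) = 0"
      unfolding g_def by (rule const[OF has_derivative_CH_metric[OF ball dr dN d2] N'(3)])
    then show ?thesis
      using \<Gamma>[of "D w" "N y" "D w"] CH_metric_deriv_commute[of "r y" "D w" "N y" "D w"]
      by (simp add: G_def linear_add[OF gl] flip: D_def)
  qed
  have "N y \<noteq> 0" using N'(2)[OF V(2)] linear_0[OF gl] by (auto simp: g_def)
  moreover have "g (N y) (D w) = 0" for w using N'(3)[OF V(2)] by (simp add: g_def D_def)
  \<comment> \<open>The real dimension 2n - 1 enters here: every vector orthogonal to
    \<open>N y\<close> is tangent, so the preimage in \<open>shape_operator\<close> exists.\<close>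
  ultimately have range: "range D = {x. g (N y) x = 0}"
    using dim inj by (intro range_eq_orthogonal_complement[OF form linD]) (auto simp: D_def)
  have DA: "D (A w) = - G w" for w
  proof -
    have "- G w \<in> range D"
      unfolding range using G_N[of w] linear_neg[OF gl] gsym[of "N y" "- G w"] by simp
    then have "\<exists>!x. D x = - G w" using inj unfolding D_def by (metis imageE injD)
    from theI'[OF this] show ?thesis
      by (simp add: A_def shape_operator_def cov_deriv_along_def G_def D_def DN_def \<Gamma>_def)
  qed
  \<comment> \<open>Each value of \<open>christoffel\<close> is a separate description, so even
    linearity comes from comparing Koszul right sides and using nondegeneracy.\<close>
  have "linear (\<lambda>u. \<Gamma> u (N y))"
  proof (rule linearI)
    note l = linear_CH_metric_deriv[of "r y"]
    have l3: "CH_metric_deriv (r y) w (u + u') v = CH_metric_deriv (r y) w u v + CH_metric_deriv (r y) w u' v"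
      "CH_metric_deriv (r y) w (c *\<^sub>R u) v = c *\<^sub>R CH_metric_deriv (r y) w u v" for w u u' v c
      using linear_add[OF l(2), of w v u u'] linear_cmul[OF l(2), of w v c u]
      by (simp_all add: CH_metric_deriv_commute[of _ w _ v])
    fix u u' :: "complex^'n" and c :: real
    have "2 * g (\<Gamma> (u + u') (N y)) w = 2 * g (\<Gamma> u (N y) + \<Gamma> u' (N y)) w" for w
      unfolding linear_add[OF gl] distrib_left \<Gamma> l3 linear_add[OF l(1)] linear_add[OF l(2)] by simp
    then show "\<Gamma> (u + u') (N y) = \<Gamma> u (N y) + \<Gamma> u' (N y)"
      by (intro inner_form_eqI[OF form]) simp
    have "2 * g (\<Gamma> (c *\<^sub>R u) (N y)) w = c * (2 * g (\<Gamma> u (N y)) w)" for w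
      unfolding \<Gamma> l3 linear_cmul[OF l(1)] linear_cmul[OF l(2)] by (simp add: algebra_simps)
    then show "\<Gamma> (c *\<^sub>R u) (N y) = c *\<^sub>R \<Gamma> u (N y)"
      by (intro inner_form_eqI[OF form]) (simp add: linear_cmul[OF gl])
  qed
  from linear_compose[OF linD this] have linG: "linear G"
    unfolding G_def o_def using linDN by (intro linear_compose_add)
  show "linear A"
  proof (rule linearI; rule injD[OF inj, folded D_def])
    show "D (A (u + w)) = D (A u + A w)" for u w
      by (simp add: DA linear_add[OF linD] linear_add[OF linG])
    show "D (A (c *\<^sub>R u)) = D (c *\<^sub>R A u)" for c u
      by (simp add: DA linear_cmul[OF linD] linear_cmul[OF linG])
  qed
  show "CH_metric (r y) (frechet_derivative r (at y) (A v)) (frechet_derivative r (at y) v) =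
      CH_metric_deriv (r y) (frechet_derivative r (at y) v) (N y) (frechet_derivative r (at y) v)
      + CH_metric (r y) (N y) (frechet_derivative (\<lambda>x. frechet_derivative r (at x) v) (at y) v)
      - CH_metric_deriv (r y) (N y) (frechet_derivative r (at y) v) (frechet_derivative r (at y) v) / 2"
    using DA[of v] G_D[of v] linear_neg[OF gl, of "G v"] unfolding g_def D_def by simp
qed

section \<open>The farthest point from the origin\<close>

text \<open>With q = 1/(1 - |z|^2) and s the inner product of \<open>u\<close> with iz, the terms in
  |z|^2 |u|^2 cancel and the value is c times q^2 (\<open>z \<bullet> d\<close>) - 2 s^2 q^2 - 2
  |z|^2 s^2 q^3. The first term is negative, the others nonpositive. Since \<open>zu\<close> is only
  real orthogonality, s need not vanish.\<close>

lemma radial_second_fundamental_form_negative: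
  assumes z: "z \<in> CH_ball" and zu: "z \<bullet> u = 0" and u: "u \<noteq> 0" and c: "0 < c"
    and d: "u \<bullet> u + z \<bullet> d \<le> 0"
  shows "CH_metric_deriv z u (c *\<^sub>R z) u + CH_metric z (c *\<^sub>R z) d
    - CH_metric_deriv z (c *\<^sub>R z) u u / 2 < 0"
proof -
  define q where "q = inverse (1 - z \<bullet> z)"
  have q: "0 < q" using z by (simp add: q_def CH_ball_inner)
  have uz: "u \<bullet> z = 0" "mult_i u \<bullet> z = - (u \<bullet> mult_i z)" "z \<bullet> mult_i u = - (u \<bullet> mult_i z)"
    using zu inner_mult_i_left[of u z] by (simp_all only: inner_commute[of u z] inner_commute[of z "mult_i u"])
  \<comment> \<open>The metric scales the radial direction by q + |z|^2 q^2, which is q^2 by the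
    choice of q.\<close>
  have "q * (1 - z \<bullet> z) = 1" using z by (simp add: q_def CH_ball_inner)
  moreover have "q\<^sup>2 = q * (q * (1 - z \<bullet> z)) + (z \<bullet> z) * q\<^sup>2"
    by (simp add: algebra_simps power2_eq_square)
  ultimately have q2: "q + (z \<bullet> z) * q\<^sup>2 = q\<^sup>2" by simp
  have "CH_metric z (c *\<^sub>R z) d = c * (z \<bullet> d) * (q + (z \<bullet> z) * q\<^sup>2)"
    by (simp add: CH_metric_eq inner_mult_i_self inner_commute[of d z] algebra_simps flip: q_def)
  moreover have "CH_metric_deriv z u (c *\<^sub>R z) u = c * ((z \<bullet> z) * (u \<bullet> u) - (u \<bullet> mult_i z)\<^sup>2) * q\<^sup>2"
    by (simp add: CH_metric_deriv_def zu uz inner_mult_i_self algebra_simps power2_eq_square[of "u \<bullet> _"] flip: q_def)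
  moreover have "CH_metric_deriv z (c *\<^sub>R z) u u / 2 =
      c * ((z \<bullet> z) * (u \<bullet> u) * q\<^sup>2 + (u \<bullet> mult_i z)\<^sup>2 * q\<^sup>2 + 2 * (z \<bullet> z) * (u \<bullet> mult_i z)\<^sup>2 * q^3)"
    by (simp add: CH_metric_deriv_def zu uz linear_cmul[OF linear_mult_i] algebra_simps
        power2_eq_square[of "u \<bullet> _"] flip: q_def)
  ultimately have "CH_metric_deriv z u (c *\<^sub>R z) u + CH_metric z (c *\<^sub>R z) d
      - CH_metric_deriv z (c *\<^sub>R z) u u / 2 =
      c * (q\<^sup>2 * (z \<bullet> d) - 2 * (u \<bullet> mult_i z)\<^sup>2 * q\<^sup>2 - 2 * (z \<bullet> z) * (u \<bullet> mult_i z)\<^sup>2 * q^3)"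
    unfolding q2 by (simp add: algebra_simps)
  moreover have "c * (q\<^sup>2 * (z \<bullet> d) - 2 * (u \<bullet> mult_i z)\<^sup>2 * q\<^sup>2
      - 2 * (z \<bullet> z) * (u \<bullet> mult_i z)\<^sup>2 * q^3) < 0"
  proof (rule mult_pos_neg[OF c])
    have "0 < u \<bullet> u" using u by simp
    with d q have "q\<^sup>2 * (z \<bullet> d) < 0" by (intro mult_pos_neg zero_less_power) linarith+
    moreover have "0 \<le> 2 * (u \<bullet> mult_i z)\<^sup>2 * q\<^sup>2" "0 \<le> 2 * (z \<bullet> z) * (u \<bullet> mult_i z)\<^sup>2 * q^3"
      using q by simp_all
    ultimately show "q\<^sup>2 * (z \<bullet> d) - 2 * (u \<bullet> mult_i z)\<^sup>2 * q\<^sup>2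
        - 2 * (z \<bullet> z) * (u \<bullet> mult_i z)\<^sup>2 * q^3 < 0" by linarith
  qed
  ultimately show ?thesis by simp
qed

text \<open>Derivative tests for the squared norm of \<open>r\<close> along the straight line
  \<open>y + t *\<^sub>R v\<close> in the parameter space, with a common factor 2 removed.\<close>

lemma farthest_point_derivatives:
  fixes r :: "'d::euclidean_space \<Rightarrow> 'a::euclidean_space"
  assumes S: "open S" "y \<in> S" and r: "smooth_on S r"
    and mx: "\<And>x. x \<in> S \<Longrightarrow> norm (r x) \<le> norm (r y)"
  shows "r y \<bullet> frechet_derivative r (at y) v = 0"
    and "frechet_derivative r (at y) v \<bullet> frechet_derivative r (at y) v
      + r y \<bullet> frechet_derivative (\<lambda>x. frechet_derivative r (at x) v) (at y) v \<le> 0"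
proof -
  define D where "D x = frechet_derivative r (at x)" for x
  define D2 where "D2 = frechet_derivative (\<lambda>x. D x v) (at y)"
  define \<gamma> where "\<gamma> t = y + t *\<^sub>R v" for t :: real
  have "open (\<gamma> -` S)"
    unfolding \<gamma>_def by (intro open_vimage S continuous_intros)
  moreover have "0 \<in> \<gamma> -` S" using S by (simp add: \<gamma>_def)
  ultimately obtain e where "0 < e" "ball 0 e \<subseteq> \<gamma> -` S" by (rule openE)
  then have e: "0 < e" "\<And>t. \<bar>t\<bar> < e \<Longrightarrow> \<gamma> t \<in> S" by (auto simp: subset_iff)
  have \<gamma>: "(\<gamma> has_derivative (\<lambda>s. s *\<^sub>R v)) (at t)" for t
    unfolding \<gamma>_def by (auto intro!: derivative_eq_intros)
  have r\<gamma>: "((\<lambda>t. r (\<gamma> t)) has_derivative (\<lambda>s. s *\<^sub>R D (\<gamma> t) v)) (at t)" if "\<bar>t\<bar> < e" for t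
    using has_derivative_compose[OF \<gamma> smooth_on_has_derivative[OF S(1) r e(2)[OF that]]]
      linear_cmul[OF has_derivative_linear[OF smooth_on_has_derivative[OF S(1) r e(2)[OF that]]]]
    by (simp add: D_def)
  have D2: "((\<lambda>x. D x v) has_derivative D2) (at y)"
    unfolding D2_def D_def
    by (rule smooth_on_has_derivative[OF S(1) smooth_on_directional_derivative[OF r] S(2)])
  have D\<gamma>: "((\<lambda>t. D (\<gamma> t) v) has_derivative (\<lambda>s. s *\<^sub>R D2 v)) (at 0)"
    using has_derivative_compose[OF \<gamma>[of 0], of "\<lambda>x. D x v" D2] D2 linear_cmul[OF has_derivative_linear[OF D2]]
    by (simp add: \<gamma>_def)
  have d: "((\<lambda>t. r (\<gamma> t) \<bullet> r (\<gamma> t)) has_real_derivative 2 * (r (\<gamma> t) \<bullet> D (\<gamma> t) v)) (at t)"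
    if "\<bar>t\<bar> < e" for t
    unfolding has_field_derivative_def
    by (rule has_derivative_eq_rhs[OF has_derivative_inner[OF r\<gamma>[OF that] r\<gamma>[OF that]]])
      (simp add: fun_eq_iff inner_commute)
  have d2: "((\<lambda>t. 2 * (r (\<gamma> t) \<bullet> D (\<gamma> t) v)) has_real_derivative
      2 * (D y v \<bullet> D y v + r y \<bullet> D2 v)) (at 0)"
    unfolding has_field_derivative_def
    using e(1)
    by (intro has_derivative_eq_rhs[OF has_derivative_mult_right[OF has_derivative_inner[OF r\<gamma>[of 0] D\<gamma>]]])
      (auto simp: fun_eq_iff \<gamma>_def algebra_simps)
  have "r (\<gamma> t) \<bullet> r (\<gamma> t) \<le> r (\<gamma> 0) \<bullet> r (\<gamma> 0)" if "\<bar>t\<bar> < e" for t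
    using mx[OF e(2)[OF that]] by (simp add: \<gamma>_def norm_le)
  from interior_max_second_derivative[OF e(1) d d2 this]
  show "r y \<bullet> frechet_derivative r (at y) v = 0"
    "frechet_derivative r (at y) v \<bullet> frechet_derivative r (at y) v
      + r y \<bullet> frechet_derivative (\<lambda>x. frechet_derivative r (at x) v) (at y) v \<le> 0"
    by (simp_all add: \<gamma>_def D_def D2_def)
qed

text \<open>The normal is taken outward; with the sign of the Weingarten formula this makes the
  second fundamental form negative definite.\<close>

lemma trace_shape_operator_neg_at_farthest_point:
  fixes r :: "real^'m::finite \<Rightarrow> complex^'n"
  assumes S: "open S" "y \<in> S" and r: "smooth_on S r" "r ` S \<subseteq> CH_ball"
    and inj: "\<And>x. x \<in> S \<Longrightarrow> inj (frechet_derivative r (at x))"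
    and dim: "CARD('m) + 1 = 2 * CARD('n)"
    and mx: "\<And>x. x \<in> S \<Longrightarrow> norm (r x) \<le> norm (r y)"
  obtains V N where "open V" "y \<in> V" "V \<subseteq> S" "unit_normal_field CH_metric r V N"
    "trace (matrix (shape_operator CH_metric r N y)) < 0"
proof -
  let ?D = "frechet_derivative r (at y)"
  note far = farthest_point_derivatives[OF S r(1) mx]
  have ball: "r y \<in> CH_ball" using r(2) S(2) by auto
  have lin: "linear ?D"
    using smooth_on_has_derivative[OF S(1) r(1) S(2)] by (rule has_derivative_linear)
  have D: "?D v \<noteq> 0" if "v \<noteq> 0" for v
    using that inj[OF S(2)] linear_0[OF lin] by (metis injD)
  \<comment> \<open>At the origin the second-order condition would read |D v|^2 \<le> 0, against
    injectivity; \<open>axis undefined 1\<close> is merely some nonzero vector.\<close>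
  have z: "r y \<noteq> 0"
  proof
    assume "r y = 0"
    then have "\<not> 0 < ?D (axis undefined 1) \<bullet> ?D (axis undefined 1)"
      using far(2)[of "axis undefined 1"] by (simp only: not_less inner_zero_left add_0_right)
    then show False using D[of "axis undefined 1"] by (simp add: axis_eq_0_iff)
  qed
  \<comment> \<open>Since z is orthogonal to iz, pairing with z in the metric is a multiple of the
    Euclidean pairing, so the Euclidean first-order condition suffices.\<close>
  have orth: "CH_metric (r y) (r y) (?D v) = 0" for v
    using far(1)[of v] by (simp add: CH_metric_eq inner_mult_i_self inner_commute)
  obtain V N c where V: "open V" "y \<in> V" "V \<subseteq> S" and N: "unit_normal_field CH_metric r V N"
    and c: "0 < c" "N y = c *\<^sub>R r y"
    by (rule unit_normal_field_exists[OF S(1) r inj S(2) z orth])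
  have rV: "smooth_on V r" "r ` V \<subseteq> CH_ball"
    using smooth_on_subset[OF r(1) V(3)] r(2) V(3) by auto
  note A = shape_operator_CH_metric[OF V(1,2) rV inj[OF S(2)] N dim]
  have "trace (matrix (shape_operator CH_metric r N y)) < 0"
  proof (rule trace_neg_of_neg_definite[OF _ A(1)])
    show "inner_form (\<lambda>v w. CH_metric (r y) (?D v) (?D w))"
      by (rule inner_form_pullback[OF inner_form_CH_metric[OF ball] lin inj[OF S(2)]])
    fix v :: "real^'m" assume "v \<noteq> 0"
    then show "CH_metric (r y) (?D (shape_operator CH_metric r N y v)) (?D v) < 0"
      unfolding A(2) c(2)
      by (intro radial_second_fundamental_form_negative ball far D c(1))
  qed
  with V N show ?thesis by (rule that)
qed

text \<open>Smoothness is given only in charts: on each chart domain \<open>f\<close> is its local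
  expression composed with the chart, and these continuous pieces are pasted.\<close>

lemma real_hypersurface_continuous_map:
  assumes "real_hypersurface X \<A> f"
  shows "continuous_map X euclidean f"
proof (rule pasting_lemma[where I = \<A> and T = fst and f = "\<lambda>_. f"])
  have atlas: "\<And>W x. (W, x) \<in> \<A> \<Longrightarrow> is_chart X (W, x)" "(\<Union>(W, x)\<in>\<A>. W) = topspace X"
    using assms by (auto simp: real_hypersurface_def smooth_manifold_def smooth_atlas_def)
  fix c assume c: "c \<in> \<A>"
  obtain W x where cW: "c = (W, x)" by force
  have chart: "openin X W" "open (x ` W)"
    "homeomorphic_map (subtopology X W) (top_of_set (x ` W)) x"
    using atlas(1) c by (auto simp: cW is_chart_def)
  show "openin X (fst c)" using chart(1) by (simp add: cW)
  have injx: "inj_on x W"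
    using homeomorphic_imp_injective_map[OF chart(3)] openin_subset[OF chart(1)]
    by (simp add: inf.absorb2)
  have "smooth_on (x ` W) (f \<circ> inv_into W x)"
    using assms c by (auto simp: real_hypersurface_def cW)
  then have "continuous_map (top_of_set (x ` W)) euclidean (f \<circ> inv_into W x)"
    unfolding continuous_map_iff_continuous by (rule smooth_on_imp_continuous_on)
  from continuous_map_compose[OF homeomorphic_imp_continuous_map[OF chart(3)] this]
  have "continuous_map (subtopology X W) euclidean (f \<circ> inv_into W x \<circ> x)" .
  then show "continuous_map (subtopology X (fst c)) euclidean f"
    unfolding cW fst_conv by (rule continuous_map_eq) (simp add: inv_into_f_f[OF injx])
next
  fix p assume "p \<in> topspace X"
  then have "p \<in> (\<Union>(W, x)\<in>\<A>. W)"
    using assms by (simp add: real_hypersurface_def smooth_manifold_def smooth_atlas_def)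
  then show "\<exists>c. c \<in> \<A> \<and> p \<in> fst c \<and> f p = f p" by fastforce
qed (rule refl)

lemma compact_real_hypersurface_not_minimal:
  fixes f :: "'p \<Rightarrow> complex^'n" and \<A> :: "('p, 'm::finite) chart set"
  assumes X: "real_hypersurface X \<A> f" and cpt: "compact_space X"
  shows "\<not> minimal_hypersurface X \<A> f"
proof -
  have "compact (f ` topspace X)"
    using image_compactin[OF _ real_hypersurface_continuous_map[OF X]] cpt
    by (simp add: compact_space_def)
  moreover have "f ` topspace X \<noteq> {}" using X by (simp add: real_hypersurface_def)
  ultimately obtain p where p: "p \<in> topspace X" "\<And>q. q \<in> topspace X \<Longrightarrow> norm (f q) \<le> norm (f p)"
    using continuous_attains_sup[of "f ` topspace X" norm] by (auto intro: continuous_intros)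
  have "p \<in> (\<Union>(W, x)\<in>\<A>. W)"
    using X p(1) by (simp add: real_hypersurface_def smooth_manifold_def smooth_atlas_def)
  then obtain W x where W: "(W, x) \<in> \<A>" "p \<in> W" by blast
  define r where "r = f \<circ> inv_into W x"
  have chart: "openin X W" "open (x ` W)"
    "homeomorphic_map (subtopology X W) (top_of_set (x ` W)) x"
    using X W(1) by (auto simp: real_hypersurface_def smooth_manifold_def smooth_atlas_def is_chart_def)
  have WX: "W \<subseteq> topspace X" using openin_subset[OF chart(1)] .
  have injx: "inj_on x W"
    using homeomorphic_imp_injective_map[OF chart(3)] WX by (simp add: inf.absorb2)
  have rp: "r (x p) = f p" by (simp add: r_def inv_into_f_f[OF injx W(2)])
  have rx: "r y \<in> f ` topspace X" if "y \<in> x ` W" for y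
    using inv_into_into[OF that] WX by (auto simp: r_def)
  obtain V N where N: "open V" "x p \<in> V" "V \<subseteq> x ` W" "unit_normal_field CH_metric r V N"
    "trace (matrix (shape_operator CH_metric r N (x p))) < 0"
  proof (rule trace_shape_operator_neg_at_farthest_point)
    show "open (x ` W)" "x p \<in> x ` W" using chart(2) W(2) by auto
    show "smooth_on (x ` W) r" "\<And>y. y \<in> x ` W \<Longrightarrow> inj (frechet_derivative r (at y))"
      "CARD('m) + 1 = 2 * CARD('n)"
      using X W(1) by (auto simp: real_hypersurface_def r_def)
    show "r ` x ` W \<subseteq> CH_ball" using rx X by (force simp: real_hypersurface_def)
    show "norm (r y) \<le> norm (r (x p))" if "y \<in> x ` W" for y
      using rx[OF that] p(2) by (auto simp: rp)
  qed
  \<comment> \<open>This membership keeps the minimality condition at \<open>p\<close> from being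
    vacuous.\<close>
  have "shape_operator CH_metric r N (x p) \<in> shape_operators_at \<A> f p"
    unfolding shape_operators_at_def using W N(1-4) by (auto simp: r_def)
  with N(5) p(1) show ?thesis
    unfolding minimal_hypersurface_def by force
qed

theorem proposition5p8:
  shows "\<not> (\<exists>(X :: 'p topology) (\<A> :: ('p, 'm::finite) chart set) (f :: 'p \<Rightarrow> complex^'n::finite).
     real_hypersurface X \<A> f \<and> compact_space X \<and> minimal_hypersurface X \<A> f \<and>
     (\<forall>p\<in>topspace X. \<forall>A\<in>shape_operators_at \<A> f p.
        shape_norm_sq A \<le> sqrt ((real CARD('n))\<^sup>2 + 12 * real CARD('n) + 12) - real CARD('n) - 4))"
  using compact_real_hypersurface_not_minimal by blast

end
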